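(* Let $n \geq 2$ be an integer. For every $t \in [0,1]$, let $\mathscr{L}_t$ be the set of lines in $\mathbb{R}^n$ which are at distance $t$ from the origin. Let $$T_n(k) = \frac{\sqrt{(k+1)(n-k)}+\sqrt{k(n-k-1)}}{n(\sqrt{k}+\sqrt{k+1})}, \qquad k = 0, 1,\dots,n-1.$$ Then $\frac{1}{\sqrt{n}} = T_n(0) > T_n(1) > T_n(2) > \dots > T_n(n-1)$ and $$\min_{\ell \in \mathscr{L}_t} |B_1^n \cap \ell| = \begin{cases} \dfrac{2}{\sqrt{n}}, & t \in [0,T_n(n-1)], \\[2mm] 2\,\dfrac{1-t\sqrt{n-k}}{\sqrt{k}}, & t \in [T_n(k),T_n(k-1)], \ k = n-1,\dots, 1, \\[2mm] 0, & t \in \left(\frac{1}{\sqrt{n}},1\right]. \end{cases}$$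
   Context: $B_1^n = \{x \in \mathbb{R}^n : \sum_{i=1}^n |x_i| \leq 1\}$ is the cross-polytope. Lines are affine lines (not necessarily through the origin), distances are Euclidean, and $|B_1^n\cap \ell|$ denotes the length (1-dimensional Lebesgue measure on $\ell$) of $B_1^n \cap \ell$, equal to $0$ if the intersection is empty. *)

theory Defs
  imports "HOL-Analysis.Analysis"
begin

definition cross_polytope :: "(real ^ 'n) set" where
  "cross_polytope = {x. (\<Sum>i\<in>UNIV. \<bar>x $ i\<bar>) \<le> 1}"

definition lines_at_distance :: "real \<Rightarrow> 'a::euclidean_space set set" where
  "lines_at_distance t = {L. affine L \<and> aff_dim L = 1 \<and> infdist 0 L = t}"

definition unit_speed_param :: "'a::euclidean_space set \<Rightarrow> (real \<Rightarrow> 'a) \<Rightarrow> bool" where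
  "unit_speed_param L g \<longleftrightarrow> (\<exists>p u. norm u = 1 \<and> g = (\<lambda>s. p + s *\<^sub>R u) \<and> range g = L)"

text \<open>
  The one-dimensional Lebesgue measure on a line \<open>L\<close> is transported from the reals along an
  isometric parametrisation of \<open>L\<close>. Such a parametrisation exists for every line
  (\<open>unit_speed_param_exists\<close>), and the result does not depend on it
  (\<open>length_on_line_eq\<close>).
\<close>

definition length_on_line :: "'a::euclidean_space set \<Rightarrow> 'a set \<Rightarrow> real" where
  "length_on_line L A = measure lebesgue ((SOME g. unit_speed_param L g) -` A)"

lemma unit_speed_param_exists:
  assumes "affine L" "aff_dim L = 1"
  shows "\<exists>g. unit_speed_param L g"
proof -
  obtain B where B: "\<not> affine_dependent B" "affine hull B = L" "int (card B) = 2"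
    using aff_dim_basis_exists[of L] assms by (auto simp: hull_same)
  then obtain a b where ab: "B = {a, b}" "a \<noteq> b"
    by (auto simp: card_2_iff)
  define u where "u = (b - a) /\<^sub>R norm (b - a)"
  have nz: "norm (b - a) \<noteq> 0" using ab by simp
  have "L = range (\<lambda>s. a + s *\<^sub>R (b - a))"
    using B(2) ab(1) affine_hull_2_alt[of a b] by auto
  also have "\<dots> = range (\<lambda>s. a + s *\<^sub>R u)"
  proof (intro equalityI subsetI; clarify)
    fix s show "a + s *\<^sub>R (b - a) \<in> range (\<lambda>s. a + s *\<^sub>R u)"
      by (rule range_eqI[of _ _ "s * norm (b - a)"]) (use nz in \<open>simp add: u_def\<close>)
  next
    fix s show "a + s *\<^sub>R u \<in> range (\<lambda>s. a + s *\<^sub>R (b - a))"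
      by (rule range_eqI[of _ _ "s / norm (b - a)"]) (simp add: u_def divide_inverse)
  qed
  finally have "range (\<lambda>s. a + s *\<^sub>R u) = L" by simp
  moreover have "norm u = 1" using nz by (simp add: u_def)
  ultimately show ?thesis unfolding unit_speed_param_def by blast
qed

lemma length_on_line_eq:
  assumes "unit_speed_param L g"
  shows "length_on_line L A = measure lebesgue (g -` A)"
proof -
  define h where "h = (SOME g. unit_speed_param L g)"
  have "unit_speed_param L h" unfolding h_def by (rule someI[of "unit_speed_param L", OF assms])
  then obtain p u where h: "norm u = 1" "h = (\<lambda>s. p + s *\<^sub>R u)" "range h = L"
    unfolding unit_speed_param_def by blast
  obtain q v where g: "norm v = 1" "g = (\<lambda>s. q + s *\<^sub>R v)" "range g = L"
    using assms unfolding unit_speed_param_def by blast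
  have "g 0 \<in> range h" "g 1 \<in> range h" using h(3) g(3) by auto
  then obtain a b where ab: "g 0 = h a" "g 1 = h b" by blast
  define m where "m = b - a"
  have q: "q = p + a *\<^sub>R u" using ab(1) g(2) h(2) by simp
  have v: "v = m *\<^sub>R u"
    using ab(2) q g(2) h(2) by (simp add: m_def algebra_simps)
  have m: "\<bar>m\<bar> = 1" using v g(1) h(1) by simp
  then have m0: "m \<noteq> 0" by auto
  have gh: "g s = h (m * s + a)" for s
    by (simp add: g(2) h(2) q v algebra_simps)
  have "h -` A = (\<lambda>s. m *\<^sub>R s + a) ` (g -` A)"
  proof (intro equalityI subsetI)
    fix x assume "x \<in> h -` A"
    then show "x \<in> (\<lambda>s. m *\<^sub>R s + a) ` (g -` A)"
      by (intro image_eqI[of _ _ "(x - a) / m"]) (use m0 in \<open>simp_all add: gh\<close>)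
  qed (auto simp: gh)
  then have "measure lebesgue (h -` A) = measure lebesgue (g -` A)"
    using measure_lebesgue_affine[of m a "g -` A"] m by (simp add: add.commute)
  then show ?thesis by (simp add: length_on_line_def h_def)
qed

definition is_minimum :: "real set \<Rightarrow> real \<Rightarrow> bool" where
  "is_minimum S m \<longleftrightarrow> m \<in> S \<and> (\<forall>x\<in>S. m \<le> x)"

definition T :: "nat \<Rightarrow> nat \<Rightarrow> real" where
  "T n k = (sqrt ((real k + 1) * (real n - real k)) + sqrt (real k * (real n - real k - 1)))
             / (real n * (sqrt (real k) + sqrt (real k + 1)))"

end

theory Submission
  imports Defs
begin

text \<open>
  Write a line at distance \<open>t\<close> from the origin as \<open>z + s u\<close> with \<open>u\<close> a unit vector, \<open>z\<close> orthogonal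
  to \<open>u\<close> and \<open>norm z = t\<close>. Its intersection with the cross-polytope is \<open>{s. l1 (z + s u) \<le> 1}\<close>,
  where \<open>l1\<close> is the sum norm, so everything is about sublevel sets of a convex function of \<open>s\<close>.

  Candidates for short chords come from a set \<open>S\<close> of \<open>k\<close> coordinates: take \<open>u\<close> constant on \<open>S\<close> and
  zero elsewhere, and \<open>z\<close> constant off \<open>S\<close> and zero on it. Then
  \<open>l1 (z + s u) = t sqrt (n - k) + sqrt k \<bar>s\<bar>\<close>, and the chord has length
  \<open>2 (1 - t sqrt (n - k)) / sqrt k\<close>, which is \<open>2 * half_chord n k t\<close>. For \<open>k = n\<close> let \<open>z\<close> be
  any vector of norm \<open>t\<close> orthogonal to the diagonal; then the chord is at most that long. The lines for \<open>k\<close> and \<open>k + 1\<close> give chords of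
  equal length exactly at \<open>t = T n k\<close>, and \<open>n * T n k\<close> is a weighted mean of \<open>sqrt (n - k)\<close> and
  \<open>sqrt (n - k - 1)\<close>, so the thresholds decrease in \<open>k\<close>; this tells which candidate is the shortest
  (\<open>half_chord_min\<close>).

  It remains to see that every chord is at least as long as one of the candidates
  (\<open>length_ge_half_chord\<close>). Compare the signs of the coordinates of the two end points of the
  chord, and let \<open>S\<close> be the set of coordinates where they differ. After changing signs of
  coordinates, the end points lie on the two hyperplanes on which \<open>\<Sum>\<^sub>i x\<^sub>i\<close>, respectively
  \<open>- \<Sum>\<^sub>i\<^sub>\<in>\<^sub>S x\<^sub>i + \<Sum>\<^sub>i\<^sub>\<notin>\<^sub>S x\<^sub>i\<close>, equals 1. Both functionals depend only on the orthogonal projection to the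
  plane spanned by the indicator vectors of \<open>S\<close> and of its complement. Projecting does not
  lengthen the chord and does not increase the distance from the origin, so the question becomes planar: a
  symmetric wedge is cut by a line at distance at most \<open>t\<close> from a point of its axis, and the sides
  of the wedge are at distance \<open>1 / sqrt n \<ge> t\<close> from that point. The cut is
  shortest when the line is perpendicular to the axis at distance exactly \<open>t\<close> (\<open>wedge_chord\<close>), and
  its length is then \<open>2 * half_chord n k t\<close> with \<open>k = card S\<close>.

  This needs \<open>z\<close> to be an interior point. It can lie on the boundary only for \<open>t = 1 / sqrt n\<close>, when
  it is the centre of a facet; the line then stays in that facet for a length of at least \<open>2 / n\<close>,
  which is no less than the candidate for \<open>k = 1\<close>. For larger \<open>t\<close>, a line parallel to a facet
  misses the polytope.
\<close>

section \<open>The thresholds\<close>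

text \<open>
  Half the length of the chord belonging to a set of \<open>k\<close> coordinates, as described above.
\<close>

definition half_chord :: "nat \<Rightarrow> nat \<Rightarrow> real \<Rightarrow> real" where
  "half_chord n k t = (1 - t * sqrt (real n - real k)) / sqrt (real k)"

lemma T_0: "n > 0 \<Longrightarrow> T n 0 = 1 / sqrt (real n)"
  by (simp add: T_def real_div_sqrt field_simps)

text \<open>
  The form of the threshold that makes its monotonicity visible: the mean of two square roots,
  which interlace for consecutive \<open>k\<close>.
\<close>

lemma T_weighted_mean:
  assumes "k < n"
  shows "real n * T n k =
    (sqrt (real k + 1) * sqrt (real n - real k) + sqrt (real k) * sqrt (real n - real k - 1))
      / (sqrt (real k + 1) + sqrt (real k))"
  using assms by (simp add: T_def real_sqrt_mult add.commute)

lemma T_strict_dec: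
  assumes "k + 1 < n"
  shows "T n (k + 1) < T n k"
proof -
  have pos: "sqrt (real j + 1) + sqrt (real j) > 0" for j
    by (simp add: add_pos_nonneg)
  have "real n * T n (k + 1) \<le> sqrt (real n - real k - 1)"
  proof -
    have "sqrt (real (k + 1)) * sqrt (real n - real (k + 1) - 1)
        \<le> sqrt (real (k + 1)) * sqrt (real n - real (k + 1))"
      by (intro mult_left_mono) auto
    then show ?thesis
      using assms pos[of "k + 1"] unfolding T_weighted_mean[OF assms]
      by (simp add: pos_divide_le_eq algebra_simps)
  qed
  also have "\<dots> < real n * T n k"
  proof -
    have "sqrt (real k + 1) * sqrt (real n - real k - 1)
        < sqrt (real k + 1) * sqrt (real n - real k)"
      by (intro mult_strict_left_mono) auto
    then show ?thesis
      using assms pos[of k] T_weighted_mean[of k n]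
      by (simp add: pos_less_divide_eq algebra_simps)
  qed
  finally show ?thesis using assms by simp
qed

lemma T_antimono:
  assumes "i \<le> j" "j < n"
  shows "T n j \<le> T n i"
  using assms
proof (induction j rule: dec_induct)
  case (step m)
  then show ?case using T_strict_dec[of m n] by simp
qed simp

text \<open>
  Since \<open>X\<^sup>2 - Y\<^sup>2 = n\<close>, rationalising shows that \<open>T n j\<close> is the quotient
  \<open>(sqrt (j + 1) - sqrt j) / (X - Y)\<close>. This is where the affine functions \<open>half_chord n j\<close> and
  \<open>half_chord n (j + 1)\<close> cross.
\<close>

lemma T_crossing:
  assumes "j < n"
  defines "X \<equiv> sqrt ((real j + 1) * (real n - real j))"
    and "Y \<equiv> sqrt (real j * (real n - real j - 1))"
  shows "Y < X" "T n j * (X - Y) = sqrt (real j + 1) - sqrt (real j)"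
proof -
  let ?D = "sqrt (real j) + sqrt (real j + 1)"
  have D: "?D > 0" by (simp add: add_nonneg_pos)
  have n: "real n > 0" using assms(1) by simp
  have "X\<^sup>2 = (real j + 1) * (real n - real j)" "Y\<^sup>2 = real j * (real n - real j - 1)"
    using assms(1) by (simp_all add: X_def Y_def)
  then have XY: "X\<^sup>2 - Y\<^sup>2 = real n" by (simp add: algebra_simps)
  have "X \<ge> 0" using assms(1) by (simp add: X_def)
  then show "Y < X" using XY n by (smt (verit) power_mono)
  have "T n j * (X - Y) = (X\<^sup>2 - Y\<^sup>2) / (real n * ?D)"
    by (simp add: T_def X_def Y_def power2_eq_square algebra_simps)
  also have "\<dots> = 1 / ?D" using XY n by simp
  also have "\<dots> = sqrt (real j + 1) - sqrt (real j)"
  proof -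
    have "(sqrt (real j + 1) - sqrt (real j)) * ?D = 1"
      by (simp add: algebra_simps)
    then show ?thesis using D by (simp add: divide_eq_eq)
  qed
  finally show "T n j * (X - Y) = sqrt (real j + 1) - sqrt (real j)" .
qed

lemma half_chord_Suc_diff:
  assumes "1 \<le> j" "j < n"
  obtains c where "c > 0" "half_chord n (Suc j) t - half_chord n j t = c * (t - T n j)"
proof -
  define X where "X = sqrt ((real j + 1) * (real n - real j))"
  define Y where "Y = sqrt (real j * (real n - real j - 1))"
  note XY = T_crossing[OF assms(2), folded X_def Y_def]
  define p where "p = sqrt (real j)"
  define q where "q = sqrt (real j + 1)"
  have pq: "p > 0" "q > 0" using assms by (simp_all add: p_def q_def)
  have "half_chord n (Suc j) t - half_chord n j t
      = (1 - t * sqrt (real n - real j - 1)) / q - (1 - t * sqrt (real n - real j)) / p"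
    by (simp add: half_chord_def p_def q_def add.commute diff_diff_eq)
  also have "\<dots> = ((1 - t * sqrt (real n - real j - 1)) * p - (1 - t * sqrt (real n - real j)) * q) / (p * q)"
    using pq by (simp add: field_simps)
  also have "(1 - t * sqrt (real n - real j - 1)) * p - (1 - t * sqrt (real n - real j)) * q
      = t * (X - Y) - (q - p)"
    unfolding X_def Y_def p_def q_def real_sqrt_mult by (simp only: algebra_simps)
  also have "\<dots> = (X - Y) * (t - T n j)"
    using XY(2) by (simp add: p_def q_def algebra_simps)
  finally have "half_chord n (Suc j) t - half_chord n j t = (X - Y) / (p * q) * (t - T n j)"
    by simp
  moreover have "(X - Y) / (p * q) > 0" using XY(1) pq by simp
  ultimately show ?thesis using that by blast
qed

text \<open>
  As the thresholds decrease, \<open>half_chord n j t\<close> decreases in \<open>j\<close> while \<open>t \<le> T n j\<close> and increases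
  afterwards, so its minimum is found by locating \<open>t\<close> between two thresholds. At \<open>k = n\<close> and \<open>k = 1\<close>
  only one neighbour has to be compared.
\<close>

lemma half_chord_min:
  assumes "1 \<le> k" "k \<le> n" "1 \<le> j" "j \<le> n"
    and lower: "k < n \<Longrightarrow> T n k \<le> t" and upper: "2 \<le> k \<Longrightarrow> t \<le> T n (k - 1)"
  shows "half_chord n k t \<le> half_chord n j t"
proof (cases "k \<le> j")
  case True
  then show ?thesis using \<open>j \<le> n\<close>
  proof (induction j rule: dec_induct)
    case (step m)
    have "T n m \<le> T n k" using step by (intro T_antimono) auto
    also have "\<dots> \<le> t" using step by (intro lower) auto
    finally have "half_chord n m t \<le> half_chord n (Suc m) t"
      using step assms(1) half_chord_Suc_diff[of m n t]
      by (smt (verit) One_nat_def Suc_le_eq le_trans mult_nonneg_nonneg)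
    then show ?case using step by simp
  qed simp
next
  case False
  then have "j \<le> k" by simp
  then show ?thesis using \<open>1 \<le> j\<close>
  proof (induction j rule: inc_induct)
    case (step m)
    have "t \<le> T n (k - 1)" using step by (intro upper) auto
    also have "\<dots> \<le> T n m" using step assms(2) by (intro T_antimono) auto
    finally have "half_chord n (Suc m) t \<le> half_chord n m t"
      using step assms(2) half_chord_Suc_diff[of m n t]
      by (smt (verit) less_le_trans mult_nonneg_nonpos)
    then show ?case using step by simp
  qed simp
qed

section \<open>Chords of a planar wedge\<close>

text \<open>
  The point \<open>z\<close> is strictly inside the downward wedge \<open>K \<bar>x\<bar> + N y \<le> 1\<close>, and \<open>z + b u\<close> and \<open>z - a u\<close>
  are beyond its right and its left side. Let \<open>A\<close> and \<open>B\<close> be the rates at which the two sides are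
  approached. Bounding \<open>a\<close> and \<open>b\<close> from below by the exit times and writing the distance of the line
  from the origin as a cross product gives
  \<open>a + b \<ge> 2 K (u1 - t N) / (A B)\<close>, where \<open>A B = M\<^sup>2 u1\<^sup>2 - N\<^sup>2\<close> and \<open>M\<^sup>2 = K\<^sup>2 + N\<^sup>2\<close>.
  The right-hand side exceeds its value at \<open>u1 = 1\<close>, the horizontal line, by a nonnegative multiple of
  \<open>u1 M\<^sup>2 + N\<^sup>2 - t N M\<^sup>2 (1 + u1)\<close>. For \<open>t M \<le> 1\<close>, that is, for a circle of radius at most the
  distance \<open>1 / M\<close> of the sides from the origin, this is at least \<open>(M - N) (M u1 - N) \<ge> 0\<close>.
\<close>

lemma wedge_chord_unit:
  fixes K N t :: real
  assumes K: "K > 0" and N: "N \<ge> 0" and t: "t \<ge> 0" "t * sqrt (K\<^sup>2 + N\<^sup>2) \<le> 1"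
    and u: "u1\<^sup>2 + u2\<^sup>2 = 1" and z: "z1\<^sup>2 + z2\<^sup>2 \<le> t\<^sup>2"
    and pos: "a > 0" "b > 0"
    and inside: "K * z1 + N * z2 < 1" "- K * z1 + N * z2 < 1"
    and right: "K * (z1 + b * u1) + N * (z2 + b * u2) \<ge> 1"
    and left: "- K * (z1 - a * u1) + N * (z2 - a * u2) \<ge> 1"
  shows "2 * ((1 - t * N) / K) \<le> a + b"
proof -
  define M where "M = sqrt (K\<^sup>2 + N\<^sup>2)"
  have M2: "M\<^sup>2 = K\<^sup>2 + N\<^sup>2" by (simp add: M_def)
  have M: "M > 0" "M \<ge> N" using K N by (auto simp: M_def real_le_rsqrt intro!: add_pos_nonneg)
  define A B where "A = K * u1 + N * u2" and "B = K * u1 - N * u2"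
  have bA: "b * A \<ge> 1 - (K * z1 + N * z2)" and aB: "a * B \<ge> 1 - (- K * z1 + N * z2)"
    using right left by (simp_all add: A_def B_def algebra_simps)
  have A: "A > 0" and B: "B > 0"
    using bA aB inside pos by (smt (verit) mult_nonneg_nonpos)+
  have u1: "u1 > 0" using A B K by (simp add: A_def B_def) (smt (verit) mult_nonneg_nonpos)
  have "u2\<^sup>2 = 1 - u1\<^sup>2" using u by simp
  moreover have "A * B = K\<^sup>2 * u1\<^sup>2 - N\<^sup>2 * u2\<^sup>2"
    by (simp add: A_def B_def algebra_simps power2_eq_square)
  ultimately have "A * B = K\<^sup>2 * u1\<^sup>2 - N\<^sup>2 * (1 - u1\<^sup>2)" by simp
  then have AB: "A * B = (M * u1)\<^sup>2 - N\<^sup>2"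
    by (simp add: M2 power_mult_distrib algebra_simps)
  then have "N\<^sup>2 < (M * u1)\<^sup>2" using A B by (smt (verit) mult_pos_pos)
  then have Mu: "N < M * u1" using M u1 by (simp add: power2_less_imp_less)
  have u1le: "u1 \<le> 1" using u by (smt (verit) zero_le_power2 power2_le_imp_le one_power2)
  have cross: "z2 * u1 - z1 * u2 \<le> t"
  proof -
    have "(z2 * u1 - z1 * u2)\<^sup>2 + (z1 * u1 + z2 * u2)\<^sup>2 = (z1\<^sup>2 + z2\<^sup>2) * (u1\<^sup>2 + u2\<^sup>2)"
      by (simp add: power2_eq_square algebra_simps)
    then have "(z2 * u1 - z1 * u2)\<^sup>2 \<le> t\<^sup>2" using u z by (smt (verit) zero_le_power2 mult_cancel_left1)
    then show ?thesis using t(1) by (rule power2_le_imp_le)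
  qed
  have "2 * (1 - t * N) * (A * B) \<le> 2 * (K\<^sup>2 * (u1 - t * N))"
  proof -
    have "K\<^sup>2 * (u1 - t * N) - (1 - t * N) * (A * B)
        = (1 - u1) * (u1 * M\<^sup>2 + N\<^sup>2 - t * N * M\<^sup>2 * (1 + u1))"
    proof -
      have K2: "K\<^sup>2 = M\<^sup>2 - N\<^sup>2" using M2 by simp
      show ?thesis unfolding AB K2 by (simp add: power2_eq_square algebra_simps)
    qed
    moreover have "t * N * M\<^sup>2 * (1 + u1) \<le> N * M * (1 + u1)"
    proof -
      have "(t * M) * (N * M * (1 + u1)) \<le> 1 * (N * M * (1 + u1))"
        using t(2) N M u1 by (intro mult_right_mono) (auto simp: M_def)
      then show ?thesis by (simp add: power2_eq_square mult_ac)
    qed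
    moreover have "u1 * M\<^sup>2 + N\<^sup>2 - N * M * (1 + u1) = (M - N) * (M * u1 - N)"
      by (simp add: power2_eq_square algebra_simps)
    moreover have "(M - N) * (M * u1 - N) \<ge> 0" using M Mu by simp
    ultimately have "K\<^sup>2 * (u1 - t * N) - (1 - t * N) * (A * B) \<ge> 0"
      using u1le by (simp add: mult_nonneg_nonneg)
    then show ?thesis by (simp only: mult.assoc)
  qed
  also have "\<dots> \<le> 2 * (K\<^sup>2 * (u1 - N * (z2 * u1 - z1 * u2)))"
    using cross N K by (simp add: mult_left_mono mult.commute[of t])
  also have "\<dots> = K * ((1 - (K * z1 + N * z2)) * B + (1 - (- K * z1 + N * z2)) * A)"
    by (simp add: A_def B_def power2_eq_square algebra_simps)
  also have "\<dots> \<le> K * ((b * A) * B + (a * B) * A)"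
    using bA aB A B K by (intro mult_left_mono add_mono mult_right_mono) auto
  also have "\<dots> = (K * (a + b)) * (A * B)" by (simp add: algebra_simps)
  finally have "2 * (1 - t * N) \<le> K * (a + b)"
    using A B by (simp add: mult_le_cancel_right)
  then show ?thesis using K by (simp add: divide_le_eq mult.commute)
qed

text \<open>
  The direction of a projected line has norm at most 1; rescaling it to norm 1 does not
  increase \<open>a + b\<close>.
\<close>

lemma wedge_chord:
  fixes K N t :: real
  assumes K: "K > 0" and N: "N \<ge> 0" and t: "t \<ge> 0" "t * sqrt (K\<^sup>2 + N\<^sup>2) \<le> 1"
    and u: "u1\<^sup>2 + u2\<^sup>2 \<le> 1" and z: "z1\<^sup>2 + z2\<^sup>2 \<le> t\<^sup>2"
    and pos: "a > 0" "b > 0"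
    and inside: "K * z1 + N * z2 < 1" "- K * z1 + N * z2 < 1"
    and right: "K * (z1 + b * u1) + N * (z2 + b * u2) \<ge> 1"
    and left: "- K * (z1 - a * u1) + N * (z2 - a * u2) \<ge> 1"
  shows "2 * ((1 - t * N) / K) \<le> a + b"
proof -
  define r where "r = sqrt (u1\<^sup>2 + u2\<^sup>2)"
  have "u1 \<noteq> 0 \<or> u2 \<noteq> 0" using right inside by auto
  then have r: "r > 0" by (simp add: r_def sum_power2_gt_zero_iff)
  have r2: "r\<^sup>2 = u1\<^sup>2 + u2\<^sup>2" by (simp add: r_def)
  have "r \<le> 1" using u by (simp add: r_def)
  have "2 * ((1 - t * N) / K) \<le> a * r + b * r"
  proof (rule wedge_chord_unit[OF K N t _ z])
    show "(u1 / r)\<^sup>2 + (u2 / r)\<^sup>2 = 1"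
      using r unfolding power_divide add_divide_distrib[symmetric] r2[symmetric] by simp
  qed (use pos r inside right left in auto)
  also have "\<dots> \<le> a * 1 + b * 1"
    using pos \<open>r \<le> 1\<close> by (intro add_mono mult_left_mono) auto
  finally show ?thesis by simp
qed

section \<open>The sum norm\<close>

definition l1 :: "real ^ 'n \<Rightarrow> real" where
  "l1 x = (\<Sum>i\<in>UNIV. \<bar>x $ i\<bar>)"

lemma l1_triangle: "l1 (x + y) \<le> l1 x + l1 y"
  unfolding l1_def by (simp flip: sum.distrib) (intro sum_mono abs_triangle_ineq)

lemma l1_scaleR: "l1 (c *\<^sub>R x) = \<bar>c\<bar> * l1 x"
  by (simp add: l1_def abs_mult sum_distrib_left)

lemma norm_le_l1: "norm x \<le> l1 x"
  unfolding l1_def by (rule norm_le_l1_cart)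

lemma norm_power2_cart: "(norm (x :: real ^ 'n))\<^sup>2 = (\<Sum>i\<in>UNIV. (x $ i)\<^sup>2)"
  by (simp add: norm_vec_def L2_set_def sum_nonneg)

lemma l1_le_norm: "l1 (x :: real ^ 'n) \<le> sqrt (real CARD('n)) * norm x"
proof (rule power2_le_imp_le)
  show "(l1 x)\<^sup>2 \<le> (sqrt (real CARD('n)) * norm x)\<^sup>2"
    using sum_squared_le_sum_of_squares[of "\<lambda>i. \<bar>x $ i\<bar>" UNIV]
    by (simp add: l1_def power_mult_distrib norm_power2_cart mult.commute)
qed simp

lemma continuous_l1_line: "continuous_on S (\<lambda>s. l1 (z + s *\<^sub>R u))"
  unfolding l1_def by (intro continuous_intros)

lemma convex_l1_line: "convex {s. l1 (z + s *\<^sub>R u) \<le> 1}"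
proof (rule convexI; clarsimp)
  fix s s' v w :: real
  assume h: "l1 (z + s *\<^sub>R u) \<le> 1" "l1 (z + s' *\<^sub>R u) \<le> 1" "0 \<le> v" "0 \<le> w" "v + w = 1"
  have "z + (v * s + w * s') *\<^sub>R u = (v + w) *\<^sub>R z + (v * s + w * s') *\<^sub>R u"
    using h by simp
  also have "\<dots> = v *\<^sub>R (z + s *\<^sub>R u) + w *\<^sub>R (z + s' *\<^sub>R u)"
    by (simp only: algebra_simps scaleR_scaleR)
  finally have "l1 (z + (v * s + w * s') *\<^sub>R u) \<le> v * l1 (z + s *\<^sub>R u) + w * l1 (z + s' *\<^sub>R u)"
    using l1_triangle[of "v *\<^sub>R (z + s *\<^sub>R u)" "w *\<^sub>R (z + s' *\<^sub>R u)"] h by (simp add: l1_scaleR)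
  also have "\<dots> \<le> v * 1 + w * 1" using h by (intro add_mono mult_left_mono) auto
  finally show "l1 (z + (v * s + w * s') *\<^sub>R u) \<le> 1" using h by simp
qed

section \<open>Lines at a given distance\<close>

lemma infdist_line:
  fixes z u :: "'a::euclidean_space"
  assumes "z \<bullet> u = 0"
  shows "infdist 0 (range (\<lambda>s. z + s *\<^sub>R u)) = norm z"
proof (rule antisym)
  have "z \<in> range (\<lambda>s. z + s *\<^sub>R u)" by (rule range_eqI[of _ _ 0]) simp
  then show "infdist 0 (range (\<lambda>s. z + s *\<^sub>R u)) \<le> norm z"
    using infdist_le[of z _ 0] by simp
  have "norm z \<le> norm (z + s *\<^sub>R u)" for s
  proof -
    have "(norm (z + s *\<^sub>R u))\<^sup>2 = (norm z)\<^sup>2 + (norm (s *\<^sub>R u))\<^sup>2"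
      using assms by (intro norm_add_Pythagorean) (simp add: orthogonal_def)
    then have "(norm z)\<^sup>2 \<le> (norm (z + s *\<^sub>R u))\<^sup>2" by simp
    then show ?thesis by (rule power2_le_imp_le) simp
  qed
  then show "norm z \<le> infdist 0 (range (\<lambda>s. z + s *\<^sub>R u))"
    unfolding infdist_def by (auto intro!: cINF_greatest)
qed

text \<open>
  The vector \<open>z\<close> is the point of the line nearest to the origin.
\<close>

lemma lines_at_distance_iff:
  fixes L :: "'a::euclidean_space set"
  shows "L \<in> lines_at_distance t \<longleftrightarrow>
    (\<exists>z u. norm u = 1 \<and> z \<bullet> u = 0 \<and> norm z = t \<and> L = range (\<lambda>s. z + s *\<^sub>R u))"
proof
  assume L: "L \<in> lines_at_distance t"
  then obtain p u where u: "norm u = 1" "range (\<lambda>s. p + s *\<^sub>R u) = L"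
    using unit_speed_param_exists[of L]
    by (auto simp: lines_at_distance_def unit_speed_param_def)
  define z where "z = p - (p \<bullet> u) *\<^sub>R u"
  have "z \<bullet> u = 0" using u(1) by (simp add: z_def inner_diff_left norm_eq_1)
  have "p + s *\<^sub>R u = z + (s + p \<bullet> u) *\<^sub>R u" and "z + s *\<^sub>R u = p + (s - p \<bullet> u) *\<^sub>R u" for s
    by (simp_all add: z_def algebra_simps)
  then have "range (\<lambda>s. z + s *\<^sub>R u) = L" unfolding u(2)[symmetric]
    by (metis (no_types, lifting) rangeI image_subsetI subset_antisym)
  then show "\<exists>z u. norm u = 1 \<and> z \<bullet> u = 0 \<and> norm z = t \<and> L = range (\<lambda>s. z + s *\<^sub>R u)"
    using infdist_line[OF \<open>z \<bullet> u = 0\<close>] L u(1) \<open>z \<bullet> u = 0\<close>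
    by (auto simp: lines_at_distance_def)
next
  assume "\<exists>z u. norm u = 1 \<and> z \<bullet> u = 0 \<and> norm z = t \<and> L = range (\<lambda>s. z + s *\<^sub>R u)"
  then obtain z u where zu: "norm u = 1" "z \<bullet> u = 0" "norm z = t" "L = range (\<lambda>s. z + s *\<^sub>R u)"
    by blast
  have L: "L = affine hull {z, z + u}" unfolding affine_hull_2_alt by (simp add: zu(4))
  have "u \<noteq> 0" using zu(1) by auto
  then have "aff_dim L = 1" by (simp add: L)
  moreover have "affine L" by (simp add: L)
  ultimately show "L \<in> lines_at_distance t"
    using infdist_line[OF zu(2)] zu by (simp add: lines_at_distance_def)
qed

lemma length_on_line_cross_polytope:
  fixes z u :: "real ^ 'n"
  assumes "norm u = 1" "L = range (\<lambda>s. z + s *\<^sub>R u)"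
  shows "length_on_line L (cross_polytope \<inter> L) = measure lebesgue {s. l1 (z + s *\<^sub>R u) \<le> 1}"
proof -
  have "unit_speed_param L (\<lambda>s. z + s *\<^sub>R u)"
    using assms by (auto simp: unit_speed_param_def)
  moreover have "(\<lambda>s. z + s *\<^sub>R u) -` (cross_polytope \<inter> L) = {s. l1 (z + s *\<^sub>R u) \<le> 1}"
    using assms(2) by (auto simp: cross_polytope_def l1_def)
  ultimately show ?thesis by (simp add: length_on_line_eq)
qed

section \<open>The lower bound\<close>

text \<open>
  The intersection is convex and bounded, so it contains the whole interval between two of its
  points and has finite measure.
\<close>

lemma length_ge_ends:
  fixes z u :: "real ^ 'n"
  assumes u: "norm u = 1" and ab: "- a \<le> b"
    and ends: "l1 (z + b *\<^sub>R u) \<le> 1" "l1 (z - a *\<^sub>R u) \<le> 1"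
  shows "a + b \<le> measure lebesgue {s. l1 (z + s *\<^sub>R u) \<le> 1}"
proof -
  let ?I = "{s. l1 (z + s *\<^sub>R u) \<le> 1}"
  have "closed_segment (- a) b \<subseteq> ?I"
    using ends by (intro closed_segment_subset convex_l1_line) auto
  then have sub: "{- a..b} \<subseteq> ?I" using ab by (simp add: closed_segment_eq_real_ivl)
  have "closed ?I"
    by (intro closed_Collect_le continuous_l1_line continuous_on_const)
  moreover have "bounded ?I"
  proof (rule boundedI)
    fix s assume "s \<in> ?I"
    then have "norm (z + s *\<^sub>R u) \<le> 1" using norm_le_l1 order_trans by blast
    then show "norm s \<le> 1 + norm z"
      using norm_triangle_ineq2[of "s *\<^sub>R u" "- z"] u by (simp add: add.commute)
  qed
  ultimately have "?I \<in> lmeasurable" by (simp add: lmeasurable_compact compact_eq_bounded_closed)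
  then have "measure lebesgue {- a..b} \<le> measure lebesgue ?I"
    using sub by (intro measure_mono_fmeasurable) auto
  then show ?thesis using ab by simp
qed

lemma ray_leaves_cross_polytope:
  fixes z u :: "real ^ 'n"
  assumes u: "norm u = 1" and z: "l1 z < 1"
  obtains b where "b > 0" "l1 (z + b *\<^sub>R u) = 1"
proof -
  have "norm ((1 + norm z) *\<^sub>R u) - norm z \<le> norm (z + (1 + norm z) *\<^sub>R u)"
    using norm_diff_ineq[of "(1 + norm z) *\<^sub>R u" z] by (simp add: add.commute)
  then have far: "1 \<le> l1 (z + (1 + norm z) *\<^sub>R u)"
    using u norm_le_l1[of "z + (1 + norm z) *\<^sub>R u"] by simp
  obtain b where "0 \<le> b" "l1 (z + b *\<^sub>R u) = 1"
    using IVT'[of "\<lambda>s. l1 (z + s *\<^sub>R u)" 0 1 "1 + norm z", OF _ far _ continuous_l1_line] z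
    by auto
  moreover from this have "b \<noteq> 0" using z by auto
  ultimately show ?thesis using that[of b] by simp
qed

text \<open>
  The reduction to the plane. The functions \<open>X\<close> and \<open>Y\<close> below are the coordinates of the orthogonal
  projection to the plane spanned by the restrictions to \<open>S\<close> and to its complement of the sign
  vector \<open>e\<close> of one end point. The two sides of the wedge are the traces of the hyperplanes with
  normal vectors \<open>e\<close> and \<open>d\<close>, which support the cross-polytope at the two end points.
\<close>

lemma chord_ge_half_chord:
  fixes z u :: "real ^ 'n"
  assumes n: "n = CARD('n)" and u: "norm u = 1" and t: "norm z * sqrt (real n) \<le> 1"
    and z: "l1 z < 1" and pos: "a > 0" "b > 0"
    and ends: "l1 (z + b *\<^sub>R u) = 1" "l1 (z - a *\<^sub>R u) = 1"
  obtains k where "1 \<le> k" "k \<le> n" "2 * half_chord n k (norm z) \<le> a + b"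
proof -
  define e where "e i = (if (z + b *\<^sub>R u) $ i \<ge> 0 then 1 else - 1 :: real)" for i
  define d where "d i = (if (z - a *\<^sub>R u) $ i \<ge> 0 then 1 else - 1 :: real)" for i
  define S where "S = {i. e i \<noteq> d i}"
  define k where "k = card S"
  have kn: "k \<le> n" using card_mono[of UNIV S] by (simp add: k_def n)
  have cardC: "card (- S) = n - k" using card_Diff_subset[of S UNIV] by (simp add: k_def n Compl_eq_Diff_UNIV)
  define \<sigma> where "\<sigma> R x = (\<Sum>i\<in>R. e i * x $ i)" for R :: "'n set" and x :: "real ^ 'n"
  have split: "(\<Sum>i\<in>UNIV. g i) = (\<Sum>i\<in>S. g i) + (\<Sum>i\<in>- S. g i)" for g :: "'n \<Rightarrow> real"
    using sum.union_disjoint[of S "- S" g] by (simp add: Compl_partition)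
  have e1: "\<bar>e i\<bar> = 1" and d1: "\<bar>d i\<bar> = 1" for i by (simp_all add: e_def d_def)
  have de: "d i = - e i" if "i \<in> S" for i
    using that by (auto simp: S_def e_def d_def split: if_splits)
  have de': "d i = e i" if "i \<in> - S" for i using that by (simp add: S_def)
  have sumd: "(\<Sum>i\<in>UNIV. d i * x $ i) = - \<sigma> S x + \<sigma> (- S) x" for x :: "real ^ 'n"
    unfolding split \<sigma>_def using de de' by (simp add: sum_negf)
  have sume: "(\<Sum>i\<in>UNIV. e i * x $ i) = \<sigma> S x + \<sigma> (- S) x" for x :: "real ^ 'n"
    unfolding split \<sigma>_def by simp
  have \<sigma>_line: "\<sigma> R (x + c *\<^sub>R y) = \<sigma> R x + c * \<sigma> R y" for R c and x y :: "real ^ 'n"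
    by (simp add: \<sigma>_def sum_distrib_left sum.distrib algebra_simps)
  have \<sigma>_line': "\<sigma> R (x - c *\<^sub>R y) = \<sigma> R x - c * \<sigma> R y" for R c and x y :: "real ^ 'n"
    using \<sigma>_line[of R x "- c" y] by simp
  \<comment> \<open>Cauchy-Schwarz; it also shows that an empty \<open>R\<close> gives 0, so that dividing by
    \<open>K = 0\<close> or \<open>N = 0\<close> below loses nothing.\<close>
  have cs: "(\<sigma> R x)\<^sup>2 \<le> (\<Sum>i\<in>R. (x $ i)\<^sup>2) * real (card R)" for R and x :: "real ^ 'n"
  proof -
    have "(e i * x $ i)\<^sup>2 = (x $ i)\<^sup>2" for i
      using e1[of i] by (simp add: power_mult_distrib flip: power2_abs[of "e i"])
    then show ?thesis
      using sum_squared_le_sum_of_squares[of "\<lambda>i. e i * x $ i" R] by (simp add: \<sigma>_def)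
  qed
  define K where "K = sqrt (real k)"
  define N where "N = sqrt (real n - real k)"
  define X where "X x = \<sigma> S x / K" for x :: "real ^ 'n"
  define Y where "Y x = \<sigma> (- S) x / N" for x :: "real ^ 'n"
  have KX: "\<sigma> S x = K * X x" for x
    using cs[of S x] by (auto simp: X_def K_def k_def)
  have NY: "\<sigma> (- S) x = N * Y x" for x
    using cs[of "- S" x] kn by (auto simp: Y_def N_def cardC of_nat_diff)
  have proj: "(X x)\<^sup>2 + (Y x)\<^sup>2 \<le> (norm x)\<^sup>2" for x
  proof -
    have "(X x)\<^sup>2 \<le> (\<Sum>i\<in>S. (x $ i)\<^sup>2)"
      using cs[of S x] by (cases "k = 0")
        (auto simp: X_def K_def k_def power_divide divide_le_eq sum_nonneg)
    moreover have "(Y x)\<^sup>2 \<le> (\<Sum>i\<in>- S. (x $ i)\<^sup>2)"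
      using cs[of "- S" x] kn by (cases "k = n")
        (auto simp: Y_def N_def cardC power_divide divide_le_eq sum_nonneg of_nat_diff)
    ultimately show ?thesis by (simp add: norm_power2_cart split)
  qed
  have signed_le: "(\<Sum>i\<in>UNIV. g i * z $ i) \<le> l1 z" if "\<And>i. \<bar>g i\<bar> = 1" for g
    unfolding l1_def
  proof (rule sum_mono)
    fix i show "g i * z $ i \<le> \<bar>z $ i\<bar>"
      using abs_ge_self[of "g i * z $ i"] that[of i] by (simp add: abs_mult)
  qed
  have inside: "K * X z + N * Y z < 1" "- K * X z + N * Y z < 1"
    using signed_le[of e, OF e1] signed_le[of d, OF d1] z unfolding sume sumd KX NY by simp_all
  have "(\<Sum>i\<in>UNIV. e i * (z + b *\<^sub>R u) $ i) = 1"
    unfolding ends(1)[symmetric] l1_def by (intro sum.cong) (auto simp: e_def)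
  then have right: "K * (X z + b * X u) + N * (Y z + b * Y u) \<ge> 1"
    unfolding sume \<sigma>_line KX NY by (simp add: algebra_simps)
  have "(\<Sum>i\<in>UNIV. d i * (z - a *\<^sub>R u) $ i) = 1"
    unfolding ends(2)[symmetric] l1_def by (intro sum.cong) (auto simp: d_def)
  then have left: "- K * (X z - a * X u) + N * (Y z - a * Y u) \<ge> 1"
    unfolding sumd \<sigma>_line' KX NY by (simp add: algebra_simps)
  \<comment> \<open>With equal signs at both ends, a single affine function would be below 1 at \<open>z\<close> and at
    least 1 on either side of it.\<close>
  have "k \<noteq> 0"
  proof
    assume "k = 0"
    then have "K = 0" by (simp add: K_def)
    then have "b * (N * Y u) > 0" "a * (N * Y u) < 0"
      using right left inside by (simp_all add: algebra_simps)
    then show False using pos by (auto simp: zero_less_mult_iff mult_less_0_iff)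
  qed
  have "2 * ((1 - norm z * N) / K) \<le> a + b"
  proof (rule wedge_chord[OF _ _ _ _ _ proj pos inside right left])
    show "norm z * sqrt (K\<^sup>2 + N\<^sup>2) \<le> 1" using t kn by (simp add: K_def N_def)
  qed (use kn \<open>k \<noteq> 0\<close> proj[of u] u in \<open>auto simp: K_def N_def\<close>)
  then show ?thesis using that[of k] kn \<open>k \<noteq> 0\<close> by (simp add: half_chord_def K_def N_def)
qed

text \<open>
  Equality in Cauchy-Schwarz makes all \<open>\<bar>z\<^sub>i\<bar>\<close> equal to \<open>1 / n\<close>, so \<open>z\<close> is the centre of the facet with
  normal vector \<open>z\<close>, and orthogonality to \<open>z\<close> keeps the line in the hyperplane of that facet. As
  \<open>\<bar>u\<^sub>i\<bar> \<le> 1\<close>, no coordinate changes sign for \<open>\<bar>s\<bar> \<le> 1 / n\<close>.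
\<close>

lemma facet_centre_chord:
  fixes z u :: "real ^ 'n"
  assumes n: "n = CARD('n)" and u: "norm u = 1" "z \<bullet> u = 0" and t: "norm z * sqrt (real n) \<le> 1"
    and z: "l1 z = 1"
  shows "2 / real n \<le> measure lebesgue {s. l1 (z + s *\<^sub>R u) \<le> 1}"
proof -
  have npos: "real n > 0" by (simp add: n)
  have "(norm z * sqrt (real n))\<^sup>2 \<le> 1"
    using t by (simp add: power_le_one)
  then have "(norm z)\<^sup>2 \<le> 1 / real n"
    using npos by (simp add: power_mult_distrib field_simps)
  moreover have "(\<Sum>i\<in>UNIV. (\<bar>z $ i\<bar> - 1 / real n)\<^sup>2) = (norm z)\<^sup>2 - 2 / real n * l1 z + 1 / real n"
  proof -
    have "(\<Sum>i\<in>UNIV. (\<bar>z $ i\<bar> - 1 / real n)\<^sup>2)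
        = (\<Sum>i\<in>UNIV. (z $ i)\<^sup>2 - 2 / real n * \<bar>z $ i\<bar> + (1 / real n)\<^sup>2)"
      by (intro sum.cong) (auto simp: power2_diff)
    also have "\<dots> = (norm z)\<^sup>2 - 2 / real n * l1 z + real n * (1 / real n)\<^sup>2"
      unfolding norm_power2_cart l1_def sum_distrib_left
      by (simp only: sum.distrib sum_subtractf sum_constant n)
    finally show ?thesis using npos by (simp add: power2_eq_square)
  qed
  ultimately have "(\<Sum>i\<in>UNIV. (\<bar>z $ i\<bar> - 1 / real n)\<^sup>2) \<le> 0" using z by simp
  then have "(\<Sum>i\<in>UNIV. (\<bar>z $ i\<bar> - 1 / real n)\<^sup>2) = 0"
    by (meson antisym sum_nonneg zero_le_power2)
  then have zi: "\<bar>z $ i\<bar> = 1 / real n" for i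
    by (subst (asm) sum_nonneg_eq_0_iff) auto
  have "l1 (z + s *\<^sub>R u) = 1" if s: "\<bar>s\<bar> \<le> 1 / real n" for s
  proof -
    have "\<bar>(z + s *\<^sub>R u) $ i\<bar> = real n * (z $ i * (z $ i + s * u $ i))" for i
    proof -
      have "\<bar>s * u $ i\<bar> \<le> 1 / real n * 1"
        unfolding abs_mult using s component_le_norm_cart[of u i] u by (intro mult_mono) auto
      then have "\<bar>z $ i + s * u $ i\<bar> = sgn (z $ i) * (z $ i + s * u $ i)"
        using zi[of i] by (auto simp: sgn_if)
      moreover have "real n * z $ i = sgn (z $ i)"
        using zi[of i] npos by (auto simp: sgn_if abs_if field_simps split: if_splits)
      ultimately show ?thesis by (simp flip: mult.assoc)
    qed
    then have "l1 (z + s *\<^sub>R u) = real n * (z \<bullet> (z + s *\<^sub>R u))"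
      by (simp add: l1_def inner_vec_def sum_distrib_left)
    also have "\<dots> = real n * (z \<bullet> (z + 0 *\<^sub>R u))"
      using u by (simp add: inner_add_right)
    also have "\<dots> = (\<Sum>i\<in>UNIV. real n * (z $ i)\<^sup>2)"
      by (simp add: inner_vec_def power2_eq_square sum_distrib_left)
    also have "\<dots> = (\<Sum>i\<in>(UNIV :: 'n set). 1 / real n)"
    proof (rule sum.cong)
      fix i show "real n * (z $ i)\<^sup>2 = 1 / real n"
        using npos unfolding power2_abs[of "z $ i", symmetric] zi[of i]
        by (simp add: power2_eq_square)
    qed simp
    finally show ?thesis using npos by (simp add: n)
  qed
  from this[of "1 / real n"] this[of "- (1 / real n)"] show ?thesis
    using length_ge_ends[of u "1 / real n" "1 / real n" z] u npos by simp
qed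

text \<open>
  With \<open>q = (n - 1) / n\<close> the claim is \<open>1 - sqrt q \<le> 1 - q\<close>.
\<close>

lemma half_chord_1_le:
  assumes "n \<ge> 1" "t * sqrt (real n) = 1"
  shows "half_chord n 1 t \<le> 1 / real n"
proof -
  have "t = 1 / sqrt (real n)" using assms by (simp add: field_simps)
  then have "t * sqrt (real n - 1) = sqrt ((real n - 1) / real n)"
    by (simp add: real_sqrt_divide)
  moreover have "(real n - 1) / real n \<le> sqrt ((real n - 1) / real n)"
  proof (rule real_le_rsqrt)
    have "0 \<le> (real n - 1) / real n" "(real n - 1) / real n \<le> 1" using assms by auto
    then show "((real n - 1) / real n)\<^sup>2 \<le> (real n - 1) / real n"
      unfolding power2_eq_square by (intro mult_left_le)
  qed
  moreover have "1 - (real n - 1) / real n = 1 / real n" using assms by (simp add: field_simps)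
  ultimately show ?thesis by (simp add: half_chord_def)
qed

lemma length_ge_half_chord:
  fixes z u :: "real ^ 'n"
  assumes n: "n = CARD('n)" and u: "norm u = 1" "z \<bullet> u = 0" and t: "norm z * sqrt (real n) \<le> 1"
  obtains k where "1 \<le> k" "k \<le> n"
    "2 * half_chord n k (norm z) \<le> measure lebesgue {s. l1 (z + s *\<^sub>R u) \<le> 1}"
proof -
  have "l1 z \<le> 1" using l1_le_norm[of z] t by (simp add: n mult.commute)
  then consider "l1 z < 1" | "l1 z = 1" by linarith
  then show ?thesis
  proof cases
    case 1
    obtain b where b: "b > 0" "l1 (z + b *\<^sub>R u) = 1"
      using ray_leaves_cross_polytope[OF u(1) 1] by blast
    obtain a where a: "a > 0" "l1 (z - a *\<^sub>R u) = 1"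
      using ray_leaves_cross_polytope[of "- u" z] u 1 by auto
    obtain k where k: "1 \<le> k" "k \<le> n" "2 * half_chord n k (norm z) \<le> a + b"
      using chord_ge_half_chord[OF n u(1) t 1 a(1) b(1) b(2) a(2)] by blast
    then show ?thesis
      using that[of k] length_ge_ends[of u a b z] u a b by simp
  next
    case 2
    have "norm z * sqrt (real n) = 1"
      using t 2 l1_le_norm[of z] by (simp add: n mult.commute)
    moreover have "n \<ge> 1" by (simp add: n Suc_le_eq)
    ultimately have "2 * half_chord n 1 (norm z) \<le> 2 / real n"
      using half_chord_1_le[of n "norm z"] by simp
    also have "\<dots> \<le> measure lebesgue {s. l1 (z + s *\<^sub>R u) \<le> 1}"
      by (rule facet_centre_chord[OF n u t 2])
    finally show ?thesis using that[of 1] \<open>n \<ge> 1\<close> by simp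
  qed
qed

section \<open>Extremal lines\<close>

lemma length_le_of_growth:
  fixes z u :: "real ^ 'n"
  assumes "K > 0" "C \<le> 1" and growth: "\<And>s. C + K * \<bar>s\<bar> \<le> l1 (z + s *\<^sub>R u)"
  shows "measure lebesgue {s. l1 (z + s *\<^sub>R u) \<le> 1} \<le> 2 * ((1 - C) / K)"
proof -
  define r where "r = (1 - C) / K"
  have r: "r \<ge> 0" using assms by (simp add: r_def)
  have "\<bar>s\<bar> \<le> r" if "l1 (z + s *\<^sub>R u) \<le> 1" for s
    using growth[of s] that assms(1) by (simp add: r_def pos_le_divide_eq mult.commute)
  then have "{s. l1 (z + s *\<^sub>R u) \<le> 1} \<subseteq> {- r..r}" by fastforce
  moreover have "closed {s. l1 (z + s *\<^sub>R u) \<le> 1}"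
    by (intro closed_Collect_le continuous_l1_line continuous_on_const)
  ultimately have "measure lebesgue {s. l1 (z + s *\<^sub>R u) \<le> 1} \<le> measure lebesgue {- r..r}"
    by (intro measure_mono_fmeasurable) auto
  then show ?thesis using r by (simp add: r_def)
qed

lemma inner_one_le_l1: "\<bar>x \<bullet> 1\<bar> \<le> l1 (x :: real ^ 'n)"
  by (simp add: l1_def inner_vec_def)

lemma inner_one_one: "(1 :: real ^ 'n) \<bullet> 1 = real CARD('n)"
  by (simp add: inner_vec_def)

lemma unit_vector_orthogonal_one:
  assumes "CARD('n::finite) \<ge> 2"
  obtains w :: "real ^ 'n" where "norm w = 1" "w \<bullet> 1 = 0"
proof -
  obtain i j :: 'n where "i \<noteq> j"
    using assms by (metis One_nat_def UNIV_I card_le_Suc0_iff_eq finite numeral_2_eq_2 not_less_eq_eq)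
  define v :: "real ^ 'n" where "v = axis i 1 - axis j 1"
  have "v \<bullet> 1 = 0" by (simp add: v_def inner_diff_left inner_axis')
  moreover have "v $ i = 1" using \<open>i \<noteq> j\<close> by (simp add: v_def axis_def)
  then have "v \<noteq> 0" by auto
  ultimately show ?thesis using that[of "v /\<^sub>R norm v"] by simp
qed

text \<open>
  Only an upper bound for the length is recorded here and below: the general lower bound turns it
  into an equality.
\<close>

lemma coordinate_subspace_line:
  assumes n: "n = CARD('n::finite)" and k: "1 \<le> k" "k < n" and t: "0 \<le> t" "t * sqrt (real n) \<le> 1"
  obtains z u :: "real ^ 'n" where "norm u = 1" "z \<bullet> u = 0" "norm z = t"
    "measure lebesgue {s. l1 (z + s *\<^sub>R u) \<le> 1} \<le> 2 * half_chord n k t"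
proof -
  obtain S :: "'n set" where S: "card S = k"
    using k n obtain_subset_with_card_n[of k "UNIV :: 'n set"] by auto
  have cardC: "card (- S) = n - k"
    using card_Diff_subset[of S UNIV] S by (simp add: n Compl_eq_Diff_UNIV)
  have split: "(\<Sum>i\<in>UNIV. if i \<in> S then x else y) = real k * x + real (n - k) * y" for x y :: real
    by (simp add: sum.If_cases S cardC)
  define K N where "K = sqrt (real k)" and "N = sqrt (real (n - k))"
  have K: "K > 0" "real k = K * K" and N: "N > 0" "real (n - k) = N * N"
    using k by (simp_all add: K_def N_def)
  define u z :: "real ^ 'n" where "u = (\<chi> i. if i \<in> S then 1 / K else 0)"
    and "z = (\<chi> i. if i \<in> S then 0 else t / N)"
  have "(norm u)\<^sup>2 = (\<Sum>i\<in>UNIV. if i \<in> S then (1 / K)\<^sup>2 else 0)"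
    unfolding norm_power2_cart by (intro sum.cong) (auto simp: u_def)
  then have u: "norm u = 1"
    unfolding split using K by (simp add: power_divide power2_eq_square[of K] power2_eq_1_iff)
      (use norm_ge_zero[of u] in linarith)
  have "(norm z)\<^sup>2 = (\<Sum>i\<in>UNIV. if i \<in> S then 0 else (t / N)\<^sup>2)"
    unfolding norm_power2_cart by (intro sum.cong) (auto simp: z_def)
  then have "(norm z)\<^sup>2 = t\<^sup>2"
    unfolding split using N by (simp add: power2_eq_square)
  then have z: "norm z = t" using t by (simp add: power2_eq_iff_nonneg)
  have perp: "z \<bullet> u = 0" unfolding inner_vec_def by (intro sum.neutral) (simp add: z_def u_def)
  have "l1 (z + s *\<^sub>R u) = (\<Sum>i\<in>UNIV. if i \<in> S then \<bar>s\<bar> / K else t / N)" for s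
    unfolding l1_def using K N t by (intro sum.cong) (auto simp: z_def u_def)
  then have l1: "l1 (z + s *\<^sub>R u) = t * N + K * \<bar>s\<bar>" for s
    unfolding split using K N by simp
  have "t * N \<le> t * sqrt (real n)" using t by (intro mult_left_mono) (auto simp: N_def)
  then have "measure lebesgue {s. l1 (z + s *\<^sub>R u) \<le> 1} \<le> 2 * ((1 - t * N) / K)"
    using t by (intro length_le_of_growth K(1)) (auto simp: l1)
  moreover have "N = sqrt (real n - real k)" using k by (simp add: N_def of_nat_diff)
  ultimately show ?thesis using that[OF u perp z] by (simp add: half_chord_def K_def)
qed

text \<open>
  Along the diagonal direction, the sum of the coordinates alone makes \<open>l1\<close> grow at rate \<open>sqrt n\<close>.
\<close>

lemma diagonal_line:
  assumes n: "n = CARD('n::finite)" "n \<ge> 2" and t: "0 \<le> t"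
  obtains z u :: "real ^ 'n" where "norm u = 1" "z \<bullet> u = 0" "norm z = t"
    "measure lebesgue {s. l1 (z + s *\<^sub>R u) \<le> 1} \<le> 2 * half_chord n n t"
proof -
  obtain w :: "real ^ 'n" where w: "norm w = 1" "w \<bullet> 1 = 0"
    using unit_vector_orthogonal_one n by metis
  define r where "r = sqrt (real n)"
  have r: "r > 0" "(1 :: real ^ 'n) \<bullet> 1 = r * r"
    using n by (simp_all add: r_def inner_one_one)
  define u z :: "real ^ 'n" where "u = (1 / r) *\<^sub>R 1" and "z = t *\<^sub>R w"
  have u: "norm u = 1" using r by (simp add: u_def norm_eq_sqrt_inner)
  have perp: "z \<bullet> u = 0" using w by (simp add: u_def z_def)
  have z: "norm z = t" using w t by (simp add: z_def)
  have "0 + r * \<bar>s\<bar> \<le> l1 (z + s *\<^sub>R u)" for s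
  proof -
    have "(z + s *\<^sub>R u) \<bullet> 1 = r * s"
      using w r by (simp add: u_def z_def inner_add_left)
    then show ?thesis using inner_one_le_l1[of "z + s *\<^sub>R u"] r by (simp add: abs_mult)
  qed
  then have "measure lebesgue {s. l1 (z + s *\<^sub>R u) \<le> 1} \<le> 2 * ((1 - 0) / r)"
    by (intro length_le_of_growth r(1)) simp_all
  then show ?thesis using that[OF u perp z] by (simp add: half_chord_def r_def)
qed

text \<open>
  At this distance the sum of the coordinates exceeds 1 on a whole hyperplane orthogonal to the
  diagonal, and any line in it avoids the polytope.
\<close>

lemma missing_line:
  assumes n: "n = CARD('n::finite)" "n \<ge> 2" and t: "t * sqrt (real n) > 1"
  obtains z u :: "real ^ 'n" where "norm u = 1" "z \<bullet> u = 0" "norm z = t"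
    "measure lebesgue {s. l1 (z + s *\<^sub>R u) \<le> 1} \<le> 0"
proof -
  obtain u :: "real ^ 'n" where u: "norm u = 1" "u \<bullet> 1 = 0"
    using unit_vector_orthogonal_one n by metis
  define r where "r = sqrt (real n)"
  have r: "r > 0" "(1 :: real ^ 'n) \<bullet> 1 = r * r"
    using n by (simp_all add: r_def inner_one_one)
  have "t > 0" using t r(1) by (smt (verit) r_def mult_nonpos_nonneg)
  define z :: "real ^ 'n" where "z = (t / r) *\<^sub>R 1"
  have z: "norm z = t" using r \<open>t > 0\<close> by (simp add: z_def norm_eq_sqrt_inner)
  have perp: "z \<bullet> u = 0" using u by (simp add: z_def inner_commute)
  have "l1 (z + s *\<^sub>R u) > 1" for s
  proof -
    have "(z + s *\<^sub>R u) \<bullet> 1 = t * r"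
      using u r by (simp add: z_def inner_add_left)
    then show ?thesis using inner_one_le_l1[of "z + s *\<^sub>R u"] t by (simp add: r_def)
  qed
  then have "{s. l1 (z + s *\<^sub>R u) \<le> 1} = {}" by (auto simp: not_le)
  then show ?thesis using that[OF u(1) perp z] by simp
qed

section \<open>The minimal length\<close>

lemma is_minimum_lengths:
  fixes z0 u0 :: "real ^ 'n"
  assumes lower: "\<And>z u :: real ^ 'n. norm u = 1 \<Longrightarrow> z \<bullet> u = 0 \<Longrightarrow> norm z = t \<Longrightarrow>
      v \<le> measure lebesgue {s. l1 (z + s *\<^sub>R u) \<le> 1}"
    and witness: "norm u0 = 1" "z0 \<bullet> u0 = 0" "norm z0 = t"
      "measure lebesgue {s. l1 (z0 + s *\<^sub>R u0) \<le> 1} \<le> v"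
  shows "is_minimum ((\<lambda>L. length_on_line L (cross_polytope \<inter> L)) `
    (lines_at_distance t :: (real ^ 'n) set set)) v"
  unfolding is_minimum_def
proof (intro conjI ballI)
  let ?L = "range (\<lambda>s. z0 + s *\<^sub>R u0)"
  have "v = length_on_line ?L (cross_polytope \<inter> ?L)"
    using lower[OF witness(1-3)] witness(1,4) by (simp add: length_on_line_cross_polytope)
  moreover have "?L \<in> lines_at_distance t"
    using witness by (auto simp: lines_at_distance_iff)
  ultimately show "v \<in> (\<lambda>L. length_on_line L (cross_polytope \<inter> L)) `
    (lines_at_distance t :: (real ^ 'n) set set)"
    by blast
next
  fix x assume "x \<in> (\<lambda>L. length_on_line L (cross_polytope \<inter> L)) `
    (lines_at_distance t :: (real ^ 'n) set set)"
  then obtain z u :: "real ^ 'n" where zu: "norm u = 1" "z \<bullet> u = 0" "norm z = t"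
    and x: "x = measure lebesgue {s. l1 (z + s *\<^sub>R u) \<le> 1}"
    by (auto simp: lines_at_distance_iff length_on_line_cross_polytope)
  show "v \<le> x" unfolding x by (rule lower[OF zu])
qed

lemma is_minimum_half_chord:
  assumes n: "n = CARD('n::finite)" "n \<ge> 2" and k: "1 \<le> k" "k \<le> n" and "0 \<le> t"
    and lower: "k < n \<Longrightarrow> T n k \<le> t" and upper: "t \<le> T n (k - 1)"
  shows "is_minimum ((\<lambda>L. length_on_line L (cross_polytope \<inter> L)) `
    (lines_at_distance t :: (real ^ 'n) set set)) (2 * half_chord n k t)"
proof -
  have "T n (k - 1) \<le> T n 0" using k by (intro T_antimono) auto
  then have "t \<le> 1 / sqrt (real n)" using upper n T_0[of n] by simp
  then have tn: "t * sqrt (real n) \<le> 1" using n by (simp add: field_simps)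
  have bound: "2 * half_chord n k t \<le> measure lebesgue {s. l1 (z + s *\<^sub>R u) \<le> 1}"
    if zu: "norm u = 1" "z \<bullet> u = 0" "norm z = t" for z u :: "real ^ 'n"
  proof -
    obtain j where "1 \<le> j" "j \<le> n"
      "2 * half_chord n j t \<le> measure lebesgue {s. l1 (z + s *\<^sub>R u) \<le> 1}"
      using length_ge_half_chord[OF n(1) zu(1,2)] zu(3) tn by metis
    with half_chord_min[OF k, of j t] lower upper show ?thesis by fastforce
  qed
  obtain z u :: "real ^ 'n" where "norm u = 1" "z \<bullet> u = 0" "norm z = t"
    "measure lebesgue {s. l1 (z + s *\<^sub>R u) \<le> 1} \<le> 2 * half_chord n k t"
  proof (cases "k = n")
    case True
    then show ?thesis using diagonal_line[OF n \<open>0 \<le> t\<close>] that by metis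
  next
    case False
    then have "k < n" using k by simp
    then show ?thesis using coordinate_subspace_line[OF n(1) k(1) _ \<open>0 \<le> t\<close> tn] that by metis
  qed
  then show ?thesis by (intro is_minimum_lengths bound)
qed

theorem theorem2:
  fixes n :: nat
  assumes "n = CARD('n::finite)" and "n \<ge> 2"
  shows "1 / sqrt (real n) = T n 0 \<and>
    (\<forall>k. k + 1 \<le> n - 1 \<longrightarrow> T n k > T n (k + 1)) \<and>
    (\<forall>t\<in>{0..1}.
      (let lengths = (\<lambda>L. length_on_line L (cross_polytope \<inter> L)) `
             (lines_at_distance t :: (real ^ 'n) set set)
       in (t \<in> {0..T n (n - 1)} \<longrightarrow> is_minimum lengths (2 / sqrt (real n))) \<and>
          (\<forall>k\<in>{1..n - 1}. t \<in> {T n k..T n (k - 1)} \<longrightarrow>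
             is_minimum lengths (2 * ((1 - t * sqrt (real n - real k)) / sqrt (real k)))) \<and>
          (t \<in> {1 / sqrt (real n)<..1} \<longrightarrow> is_minimum lengths 0)))"
  unfolding Let_def
proof (intro conjI allI ballI impI)
  show "1 / sqrt (real n) = T n 0" using assms by (simp add: T_0)
next
  fix k assume "k + 1 \<le> n - 1"
  then show "T n k > T n (k + 1)" using assms by (intro T_strict_dec) simp
next
  fix t :: real assume t: "t \<in> {0..1}" "t \<in> {0..T n (n - 1)}"
  have "half_chord n n t = 1 / sqrt (real n)" by (simp add: half_chord_def)
  then show "is_minimum ((\<lambda>L. length_on_line L (cross_polytope \<inter> L)) `
      (lines_at_distance t :: (real ^ 'n) set set)) (2 / sqrt (real n))"
    using is_minimum_half_chord[OF assms, of n t] assms t by simp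
next
  fix t :: real and k assume "t \<in> {0..1}" and k: "k \<in> {1..n - 1}" and "t \<in> {T n k..T n (k - 1)}"
  moreover have "k \<le> n" using k by auto
  ultimately show "is_minimum ((\<lambda>L. length_on_line L (cross_polytope \<inter> L)) `
      (lines_at_distance t :: (real ^ 'n) set set))
      (2 * ((1 - t * sqrt (real n - real k)) / sqrt (real k)))"
    using is_minimum_half_chord[OF assms, of k t] by (simp add: half_chord_def)
next
  fix t :: real assume t: "t \<in> {0..1}" "t \<in> {1 / sqrt (real n)<..1}"
  then have "t * sqrt (real n) > 1" using assms by (simp add: field_simps)
  then obtain z u :: "real ^ 'n" where "norm u = 1" "z \<bullet> u = 0" "norm z = t"
    "measure lebesgue {s. l1 (z + s *\<^sub>R u) \<le> 1} \<le> 0"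
    using missing_line[OF assms] by metis
  then show "is_minimum ((\<lambda>L. length_on_line L (cross_polytope \<inter> L)) `
      (lines_at_distance t :: (real ^ 'n) set set)) 0"
    by (intro is_minimum_lengths) simp_all
qed

end
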